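(* Let $\mathbb{C}\mathrm{H}(n)=G/H$ with $G=F_rN$ be a non-symmetric homogeneous description and $\tilde\nabla$ the canonical connection of a reductive decomposition $\mathfrak{g}=\mathfrak{h}+\mathfrak{m}$. Then the curvature form $\tilde R$ of $\tilde\nabla$ is given, for $X,Y\in\mathfrak{n}_1$, by $$\tilde R_{\tilde A_0\tilde X}=-\varphi(fX),\qquad \tilde R_{\tilde A_0\tilde N_2}=-2\varphi(N_2),\qquad \tilde R_{\tilde N_2\tilde X}=0,$$ $$\tilde R_{\tilde X\tilde Y}=-2\,\omega_0(X,Y)\,\varphi(N_2)-[\varphi(X),\varphi(Y)],$$ where $f=\mathrm{Id}+\mathrm{ad}_{H_{r0}}:\mathfrak{n}_1\to\mathfrak{n}_1$ and $H_{r0}=H_r+\varphi(A_0)$.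
   Context: Fix $n\ge1$. $\mathrm{SU}(n,1)$ is the group of determinant-one complex $(n+1)\times(n+1)$ matrices preserving the Hermitian form $\hat h(X,Y)=\overline{Y_1}X_1+\dots+\overline{Y_{n-1}}X_{n-1}+\overline{Y_{n+1}}X_n+\overline{Y_n}X_{n+1}$; $\mathbb{C}\mathrm{H}(n)$ is the space of $\hat h$-negative lines with its invariant Kähler metric, with base point $o$ the line spanned by $(0,\dots,0,1,-1)$. Matrices are in blocks of sizes $n-1,1,1$. Put $\mathfrak{s}(\mathfrak{u}(n-1)+\mathfrak{u}(1))=\{\mathrm{diag}(B,ic,ic): B\in\mathfrak{u}(n-1),c\in\mathbb{R},\mathrm{tr}B+2ic=0\}$, with connected group $\mathrm{S}(\mathrm{U}(n-1)\mathrm{U}(1))$; $A_0=\mathrm{diag}(0,\dots,0,1,-1)$, $\mathfrak{a}=\mathbb{R}A_0$, $A=\exp\mathfrak{a}$; $\mathfrak{n}_1=\left\{\begin{pmatrix}0&0&v\\-v^*&0&0\\0&0&0\end{pmatrix}: v\in\mathbb{C}^{n-1}\right\}\cong\mathbb{C}^{n-1}$; $N_2=\begin{pmatrix}0&0&0\\0&0&i\\0&0&0\end{pmatrix}$, $\mathfrak{n}_2=\mathbb{R}N_2$, $\mathfrak{n}=\mathfrak{n}_1+\mathfrak{n}_2$, $N=\exp\mathfrak{n}$. For $X,Y\in\mathfrak{n}_1$ corresponding to $v,w\in\mathbb{C}^{n-1}$, $\omega_0(X,Y)=\mathrm{Im}(w^*v)$, so $[X,Y]=2\omega_0(X,Y)N_2$.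 Non-symmetric description: $G=F_rN$, where $F_r$ is a connected closed subgroup of $\mathrm{S}(\mathrm{U}(n-1)\mathrm{U}(1))A$ with non-trivial projection to $A$, and $H=F_r\cap \mathrm{S}(\mathrm{U}(n-1)\mathrm{U}(1))$; $\mathfrak{g},\mathfrak{h},\mathfrak{f}_r$ are the Lie algebras of $G,H,F_r$. Let $\mathfrak{a}_r$ be the orthogonal complement of $\mathfrak{h}$ in $\mathfrak{f}_r$ for $k(E,E')=\mathrm{Re}\,\mathrm{tr}(E^*E')$; it is one-dimensional, $\mathfrak{a}_r=\mathbb{R}A_r$ with $A_r=A_0+H_r$, $H_r\in\mathfrak{s}(\mathfrak{u}(n-1)+\mathfrak{u}(1))$. Put $\mathfrak{s}=\mathfrak{a}+\mathfrak{n}$, $\mathfrak{s}_r=\mathfrak{a}_r+\mathfrak{n}$, and let $\chi_r:\mathfrak{s}\to\mathfrak{s}_r$ be linear, the identity on $\mathfrak{n}$, with $\chi_r(A_0)=A_r$. Given a reductive decomposition $\mathfrak{g}=\mathfrak{h}+\mathfrak{m}$ ($\mathfrak{m}$ an $\mathrm{Ad}(H)$-invariant complement), $\mathfrak{m}$ is the graph of a unique $\mathfrak{h}$-equivariant linear map $\varphi_r:\mathfrak{s}_r\to\mathfrak{h}$; put $\varphi=\varphi_r\circ\chi_r:\mathfrak{s}\to\mathfrak{h}$ and $\tilde X=\chi_r(X)+\varphi(X)$, so $X\mapsto\tilde X$ is a linear isomorphism $\mathfrak{s}\to\mathfrak{m}\cong T_o\mathbb{C}\mathrm{H}(n)$.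 Convention: curvature $\tilde R$ and torsion $\tilde T$ of the canonical connection at $o$ are normalized by $[B,C]=\tilde R_{BC}-\tilde T_BC$ for $B,C\in\mathfrak{m}$, i.e. $\tilde R_{BC}=[B,C]_{\mathfrak{h}}$ (acting on $\mathfrak{m}$ by $\mathrm{ad}$) and $\tilde T_BC=-[B,C]_{\mathfrak{m}}$. *)

theory Defs
  imports "HOL-Analysis.Analysis"
begin

text \<open>
  Conventions. Square complex matrices of size n+1 are indexed by a finite type with n+1
  elements. Two distinct indices p and q name the last two coordinates n and n+1; the remaining
  n-1 indices form the first block. Such p, q exist exactly when n \<ge> 1, and for n = 1 the first
  block is empty (which is why the index type is not of the form 'm option option).
\<close>

type_synonym 'i cmat = "complex^'i^'i"

definition bracket :: "'i::finite cmat \<Rightarrow> 'i cmat \<Rightarrow> 'i cmat" where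
  "bracket X Y = X ** Y - Y ** X"

definition cadjoint :: "'i::finite cmat \<Rightarrow> 'i cmat" where
  "cadjoint X = map_matrix cnj (transpose X)"

definition mat_pow :: "'i::finite cmat \<Rightarrow> nat \<Rightarrow> 'i cmat" where
  "mat_pow X k = (((**) X) ^^ k) (mat 1)"

definition mat_exp :: "'i::finite cmat \<Rightarrow> 'i cmat" where
  "mat_exp X = (\<Sum>k. (1 / fact k) *\<^sub>R mat_pow X k)"

definition mat_set_mult :: "'i::finite cmat set \<Rightarrow> 'i cmat set \<Rightarrow> 'i cmat set" where
  "mat_set_mult S T = {s ** t | s t. s \<in> S \<and> t \<in> T}"

definition matrix_group :: "'i::finite cmat set \<Rightarrow> bool" where
  "matrix_group G \<longleftrightarrow> mat 1 \<in> G \<and> (\<forall>g\<in>G. \<forall>h\<in>G. g ** h \<in> G) \<and>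
     (\<forall>g\<in>G. invertible g \<and> matrix_inv g \<in> G)"

text \<open>
  The Lie algebra of a matrix group is its tangent space at the identity. For the closed matrix
  groups to which it is applied, this is the set of X with exp(tX) in the group for all real t.
\<close>

definition lie_alg :: "'i::finite cmat set \<Rightarrow> 'i cmat set" where
  "lie_alg G = {X. \<exists>\<gamma>. (\<forall>t. \<gamma> t \<in> G) \<and> \<gamma> C1_differentiable_on UNIV \<and>
      \<gamma> 0 = mat 1 \<and> (\<gamma> has_vector_derivative X) (at 0)}"

subsection \<open>The group SU(n,1) and its subgroups\<close>

definition hform :: "'i::finite \<Rightarrow> 'i \<Rightarrow> complex^'i \<Rightarrow> complex^'i \<Rightarrow> complex" where
  "hform p q X Y =
     (\<Sum>i\<in>UNIV - {p, q}. cnj (Y $ i) * X $ i) + cnj (Y $ q) * X $ p + cnj (Y $ p) * X $ q"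

definition SU_n1 :: "'i::finite \<Rightarrow> 'i \<Rightarrow> 'i cmat set" where
  "SU_n1 p q = {g. det g = 1 \<and> (\<forall>X Y. hform p q (g *v X) (g *v Y) = hform p q X Y)}"

text \<open>Matrices of the form diag(B, z, z), with B of size n-1.\<close>

definition block_diag :: "'i::finite \<Rightarrow> 'i \<Rightarrow> 'i cmat \<Rightarrow> bool" where
  "block_diag p q X \<longleftrightarrow>
     (\<forall>i j. i \<noteq> j \<and> (i \<in> {p, q} \<or> j \<in> {p, q}) \<longrightarrow> X $ i $ j = 0) \<and> X $ p $ p = X $ q $ q"

text \<open>
  The Lie algebra s(u(n-1)+u(1)): a matrix diag(B, z, z) is skew-Hermitian iff B is and z is
  purely imaginary.
\<close>

definition suu :: "'i::finite \<Rightarrow> 'i \<Rightarrow> 'i cmat set" where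
  "suu p q = {E. block_diag p q E \<and> cadjoint E = - E \<and> trace E = 0}"

text \<open>
  The connected group S(U(n-1)U(1)): a matrix diag(B, z, z) preserves the Hermitian form iff B is
  unitary and z has modulus 1. These matrices of determinant 1 form a connected group if n \<ge> 2;
  for n = 1 they are the two matrices 1 and -1, and the connected group with Lie algebra suu = 0
  is trivial. Passing to the identity component covers both cases.
\<close>

definition SUU :: "'i::finite \<Rightarrow> 'i \<Rightarrow> 'i cmat set" where
  "SUU p q = connected_component_set {g \<in> SU_n1 p q. block_diag p q g} (mat 1)"

definition A0 :: "'i::finite \<Rightarrow> 'i \<Rightarrow> 'i cmat" where
  "A0 p q = (\<chi> i j. if i = p \<and> j = p then 1 else if i = q \<and> j = q then - 1 else 0)"

definition lie_a :: "'i::finite \<Rightarrow> 'i \<Rightarrow> 'i cmat set" where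
  "lie_a p q = span {A0 p q}"

definition A_group :: "'i::finite \<Rightarrow> 'i \<Rightarrow> 'i cmat set" where
  "A_group p q = mat_exp ` lie_a p q"

text \<open>
  The element of the first root space corresponding to the vector of the v_i with i distinct
  from p and q; the components of v at p and q are ignored.
\<close>

definition n1_elem :: "'i::finite \<Rightarrow> 'i \<Rightarrow> complex^'i \<Rightarrow> 'i cmat" where
  "n1_elem p q v = (\<chi> i j. if i \<notin> {p, q} \<and> j = q then v $ i
                           else if i = p \<and> j \<notin> {p, q} then - cnj (v $ j) else 0)"

definition lie_n1 :: "'i::finite \<Rightarrow> 'i \<Rightarrow> 'i cmat set" where
  "lie_n1 p q = range (n1_elem p q)"

definition N2 :: "'i::finite \<Rightarrow> 'i \<Rightarrow> 'i cmat" where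
  "N2 p q = (\<chi> i j. if i = p \<and> j = q then \<i> else 0)"

definition lie_n2 :: "'i::finite \<Rightarrow> 'i \<Rightarrow> 'i cmat set" where
  "lie_n2 p q = span {N2 p q}"

definition lie_n :: "'i::finite \<Rightarrow> 'i \<Rightarrow> 'i cmat set" where
  "lie_n p q = lie_n1 p q + lie_n2 p q"

definition N_group :: "'i::finite \<Rightarrow> 'i \<Rightarrow> 'i cmat set" where
  "N_group p q = mat_exp ` lie_n p q"

text \<open>Im (w* v), where v and w are read off from column q of X and Y.\<close>

definition omega0 :: "'i::finite \<Rightarrow> 'i \<Rightarrow> 'i cmat \<Rightarrow> 'i cmat \<Rightarrow> real" where
  "omega0 p q X Y = Im (\<Sum>i\<in>UNIV - {p, q}. cnj (Y $ i $ q) * X $ i $ q)"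

subsection \<open>Non-symmetric descriptions and reductive decompositions\<close>

text \<open>
  The possible groups F = F_r. The projection of SUU A to A sends k a to a, so it is non-trivial
  on F iff F contains some k a with a distinct from 1.
\<close>

definition nonsymmetric_F :: "'i::finite \<Rightarrow> 'i \<Rightarrow> 'i cmat set \<Rightarrow> bool" where
  "nonsymmetric_F p q F \<longleftrightarrow>
     matrix_group F \<and> connected F \<and> closed F \<and>
     F \<subseteq> mat_set_mult (SUU p q) (A_group p q) \<and>
     (\<exists>k\<in>SUU p q. \<exists>a\<in>A_group p q. k ** a \<in> F \<and> a \<noteq> mat 1)"

definition kform :: "'i::finite cmat \<Rightarrow> 'i cmat \<Rightarrow> real" where
  "kform E E' = Re (trace (cadjoint E ** E'))"

definition orth_complement :: "'i::finite cmat set \<Rightarrow> 'i cmat set \<Rightarrow> 'i cmat set" where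
  "orth_complement hh ff = {E \<in> ff. \<forall>Z\<in>hh. kform E Z = 0}"

definition reductive_decomposition ::
    "'i::finite cmat set \<Rightarrow> 'i cmat set \<Rightarrow> 'i cmat set \<Rightarrow> bool" where
  "reductive_decomposition G H m \<longleftrightarrow>
     subspace m \<and> lie_alg G = lie_alg H + m \<and> lie_alg H \<inter> m = {0} \<and>
     (\<forall>g\<in>H. \<forall>X\<in>m. g ** X ** matrix_inv g \<in> m)"

text \<open>The map from a complement of hh to hh whose graph is m.\<close>

definition graph_map :: "'i::finite cmat set \<Rightarrow> 'i cmat set \<Rightarrow> 'i cmat \<Rightarrow> 'i cmat" where
  "graph_map hh m S = (THE Z. Z \<in> hh \<and> S + Z \<in> m)"

definition h_part :: "'i::finite cmat set \<Rightarrow> 'i cmat set \<Rightarrow> 'i cmat \<Rightarrow> 'i cmat" where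
  "h_part hh m W = (THE Z. Z \<in> hh \<and> W - Z \<in> m)"

text \<open>
  Curvature at the base point, as a form on m with values in hh, which acts on m by ad. The sign
  is that of the convention [B,C] = R_BC - T_B C.
\<close>

definition canonical_curvature ::
    "'i::finite cmat set \<Rightarrow> 'i cmat set \<Rightarrow> 'i cmat \<Rightarrow> 'i cmat \<Rightarrow> 'i cmat" where
  "canonical_curvature hh m B C = h_part hh m (bracket B C)"

end

theory Submission
  imports Defs
begin

text \<open>
  Ad(H)-invariance makes m stable under ad(hh), so brackets such as [tilde A0, phi X],
  [phi N2, tilde X], [phi X, tilde Y] and [tilde X, phi Y] lie in m and do not contribute to the
  curvature. As Hr0 and hh commute with N2, what remains of [tilde A0, tilde X] and
  [tilde A0, tilde N2] is an element S of n, whose hh-part is -phi S, and nothing remains of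
  [tilde N2, tilde X]. In [tilde X, tilde Y] there also remains -[phi X, phi Y], because
  [phi X, tilde Y] + [tilde X, phi Y] counts [phi X, phi Y] twice.
\<close>

section \<open>Matrix product, bracket, adjoint and inverse\<close>

lemma bounded_bilinear_matrix_mult:
  "bounded_bilinear ((**) :: 'i::finite cmat \<Rightarrow> 'i cmat \<Rightarrow> 'i cmat)"
proof -
  have "bilinear ((**) :: 'i cmat \<Rightarrow> 'i cmat \<Rightarrow> 'i cmat)"
    by (auto simp: bilinear_def matrix_matrix_mult_def vec_eq_iff algebra_simps sum.distrib
        scaleR_sum_right intro!: linearI)
  then show ?thesis
    by (simp add: bilinear_conv_bounded_bilinear)
qed

interpretation mat_mult: bounded_bilinear "(**) :: 'i::finite cmat \<Rightarrow> 'i cmat \<Rightarrow> 'i cmat"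
  by (rule bounded_bilinear_matrix_mult)

interpretation bracket: bounded_bilinear "bracket :: 'i::finite cmat \<Rightarrow> 'i cmat \<Rightarrow> 'i cmat"
proof -
  have "bilinear (bracket :: 'i::finite cmat \<Rightarrow> 'i cmat \<Rightarrow> 'i cmat)"
    by (auto simp: bilinear_def bracket_def mat_mult.add_left mat_mult.add_right
        mat_mult.scaleR_left mat_mult.scaleR_right algebra_simps intro!: linearI)
  then show "bounded_bilinear (bracket :: 'i::finite cmat \<Rightarrow> 'i cmat \<Rightarrow> 'i cmat)"
    by (simp add: bilinear_conv_bounded_bilinear)
qed

lemma bracket_swap: "bracket X Y = - bracket Y X"
  by (simp add: bracket_def)

lemma bounded_linear_cadjoint: "bounded_linear (cadjoint :: 'i::finite cmat \<Rightarrow> 'i cmat)"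
  unfolding linear_conv_bounded_linear[symmetric]
  by (auto simp: cadjoint_def transpose_def vec_eq_iff intro!: linearI)

lemma cadjoint_mat_1 [simp]: "cadjoint (mat 1) = mat 1"
  by (auto simp: cadjoint_def transpose_def mat_def vec_eq_iff)

text \<open>For unitary \<open>g\<close> this turns \<open>matrix_inv g\<close> into
  \<open>cadjoint g\<close>, which is real-linear in \<open>g\<close>, so conjugation along a curve
  can be differentiated by the product rule.\<close>

lemma matrix_inv_unique:
  fixes g h :: "'i::finite cmat"
  assumes "h ** g = mat 1"
  shows "matrix_inv g = h"
proof -
  have gh: "g ** h = mat 1"
    using assms matrix_left_right_inverse by blast
  then have "invertible g"
    using assms invertible_def by blast
  then have "matrix_inv g ** g = mat 1"
    unfolding invertible_def matrix_inv_def by (rule someI2_ex) simp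
  then have "(matrix_inv g ** g) ** h = h"
    by simp
  then show ?thesis
    using gh by (simp add: matrix_mul_assoc[symmetric])
qed

section \<open>Lie algebras as tangent spaces of matrix groups\<close>

text \<open>Difference quotients of \<open>c\<close> stay in \<open>S\<close>, and subspaces of a
  Euclidean space are closed.\<close>

lemma has_vector_derivative_in_subspace:
  fixes c :: "real \<Rightarrow> 'a::euclidean_space"
  assumes S: "subspace S" and c: "\<And>t. c t \<in> S" and d: "(c has_vector_derivative D) (at x)"
  shows "D \<in> S"
proof -
  have "((\<lambda>h. (c (x + h) - c x) /\<^sub>R h) \<longlongrightarrow> D) (at 0)"
  proof -
    have "((\<lambda>h. norm (c (x + h) - c x - h *\<^sub>R D) / norm h) \<longlongrightarrow> 0) (at 0)"
      using d by (simp add: has_vector_derivative_def has_derivative_at)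
    moreover have "\<forall>\<^sub>F h in at 0. norm (c (x + h) - c x - h *\<^sub>R D) / norm h
        = norm ((c (x + h) - c x) /\<^sub>R h - D)"
    proof (rule eventually_at_topological[THEN iffD2], intro exI[of _ UNIV] conjI ballI impI)
      fix h :: real assume "h \<noteq> 0"
      then have "(c (x + h) - c x) /\<^sub>R h - D = (c (x + h) - c x - h *\<^sub>R D) /\<^sub>R h"
        by (simp add: scaleR_diff_right)
      then show "norm (c (x + h) - c x - h *\<^sub>R D) / norm h
          = norm ((c (x + h) - c x) /\<^sub>R h - D)"
        by (simp add: divide_inverse mult.commute)
    qed auto
    ultimately have "((\<lambda>h. norm ((c (x + h) - c x) /\<^sub>R h - D)) \<longlongrightarrow> 0) (at 0)"
      by (rule Lim_transform_eventually)
    then show ?thesis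
      by (rule LIM_zero_cancel[OF tendsto_norm_zero_cancel])
  qed
  moreover have "(c (x + h) - c x) /\<^sub>R h \<in> S" for h
    by (intro subspace_scale subspace_diff S c)
  ultimately show ?thesis
    by (intro Lim_in_closed_set[OF closed_subspace[OF S]]) auto
qed

lemma lie_alg_mono: "G \<subseteq> G' \<Longrightarrow> lie_alg G \<subseteq> lie_alg G'"
  unfolding lie_alg_def by blast

lemma lie_algI:
  assumes "\<And>t. \<gamma> t \<in> G" "\<gamma> 0 = mat 1"
    and "\<And>t. (\<gamma> has_vector_derivative D t) (at t)" "continuous_on UNIV D" "D 0 = X"
  shows "X \<in> lie_alg G"
  unfolding lie_alg_def C1_differentiable_on_def using assms by blast

text \<open>Continuity of the curve is recorded along with its velocity \<open>D\<close>, for the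
  later argument with connected components.\<close>

lemma lie_algE:
  assumes "X \<in> lie_alg G"
  obtains \<gamma> D where "\<And>t. \<gamma> t \<in> G" "\<gamma> 0 = mat 1"
    and "\<And>t. (\<gamma> has_vector_derivative D t) (at t)" "continuous_on UNIV D" "D 0 = X"
    and "continuous_on UNIV \<gamma>"
proof -
  obtain \<gamma> D where *: "\<forall>t. \<gamma> t \<in> G" "\<gamma> 0 = mat 1" "(\<gamma> has_vector_derivative X) (at 0)"
    "\<forall>t. (\<gamma> has_vector_derivative D t) (at t)" "continuous_on UNIV D"
    using assms unfolding lie_alg_def C1_differentiable_on_def by blast
  moreover have "D 0 = X"
    using * vector_derivative_unique_at by blast
  moreover have "continuous_on UNIV \<gamma>"
    using * has_vector_derivative_continuous by (blast intro: continuous_at_imp_continuous_on)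
  ultimately show ?thesis
    using that by blast
qed

text \<open>Run the curve at speed \<open>c\<close>.\<close>

lemma lie_alg_scale:
  assumes "X \<in> lie_alg G"
  shows "c *\<^sub>R X \<in> lie_alg G"
  using assms
proof (rule lie_algE)
  fix \<gamma> D
  assume a: "\<And>t. \<gamma> t \<in> G" "\<gamma> 0 = mat 1" "\<And>t. (\<gamma> has_vector_derivative D t) (at t)"
    "continuous_on UNIV D" "D 0 = X"
  show ?thesis
  proof (rule lie_algI)
    show "((\<lambda>t. \<gamma> (c * t)) has_vector_derivative c *\<^sub>R D (c * t)) (at t)" for t
    proof -
      have "((\<lambda>t. c * t) has_vector_derivative c) (at t)"
        by (auto intro!: derivative_eq_intros)
      from vector_diff_chain_at[OF this a(3)] show ?thesis
        by (simp add: o_def)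
    qed
    show "continuous_on UNIV (\<lambda>t. c *\<^sub>R D (c * t))"
      by (intro continuous_intros continuous_on_compose2[OF a(4)]) auto
  qed (use a in auto)
qed

text \<open>Multiply the two curves pointwise: both pass through the identity at time 0, so the
  product rule there gives the sum of the velocities.\<close>

lemma lie_alg_add:
  assumes G: "\<And>g h. g \<in> G \<Longrightarrow> h \<in> G \<Longrightarrow> g ** h \<in> G"
    and X: "X \<in> lie_alg G" and Y: "Y \<in> lie_alg G"
  shows "X + Y \<in> lie_alg G"
proof -
  obtain \<gamma> D where a: "\<And>t. \<gamma> t \<in> G" "\<gamma> 0 = mat 1" "\<And>t. (\<gamma> has_vector_derivative D t) (at t)"
    "continuous_on UNIV D" "D 0 = X" "continuous_on UNIV \<gamma>"
    using X lie_algE by blast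
  obtain \<delta> E where b: "\<And>t. \<delta> t \<in> G" "\<delta> 0 = mat 1" "\<And>t. (\<delta> has_vector_derivative E t) (at t)"
    "continuous_on UNIV E" "E 0 = Y" "continuous_on UNIV \<delta>"
    using Y lie_algE by blast
  show ?thesis
  proof (rule lie_algI)
    show "((\<lambda>t. \<gamma> t ** \<delta> t) has_vector_derivative (\<gamma> t ** E t + D t ** \<delta> t)) (at t)" for t
      by (rule mat_mult.has_vector_derivative[OF a(3) b(3)])
    show "continuous_on UNIV (\<lambda>t. \<gamma> t ** E t + D t ** \<delta> t)"
      by (intro continuous_intros mat_mult.continuous_on a b)
  qed (use a b G in auto)
qed

lemma subspace_lie_alg:
  assumes "mat 1 \<in> G" "\<And>g h. g \<in> G \<Longrightarrow> h \<in> G \<Longrightarrow> g ** h \<in> G"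
  shows "subspace (lie_alg G)"
proof -
  have "0 \<in> lie_alg G"
    by (rule lie_algI[of "\<lambda>_. mat 1" _ "\<lambda>_. 0"]) (use assms in auto)
  then show ?thesis
    by (simp add: subspace_def lie_alg_add assms lie_alg_scale)
qed

lemma lie_alg_conj:
  fixes g g' :: "'i::finite cmat"
  assumes "X \<in> lie_alg G" "\<And>h. h \<in> G \<Longrightarrow> g ** h ** g' \<in> G'" "g ** g' = mat 1"
  shows "g ** X ** g' \<in> lie_alg G'"
  using assms(1)
proof (rule lie_algE)
  fix \<gamma> D
  assume a: "\<And>t. \<gamma> t \<in> G" "\<gamma> 0 = mat 1" "\<And>t. (\<gamma> has_vector_derivative D t) (at t)"
    "continuous_on UNIV D" "D 0 = X"
  have l: "bounded_linear (\<lambda>x. g ** x ** g')"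
    using bounded_linear_compose[of "\<lambda>y. y ** g'" "\<lambda>x. g ** x"]
      mat_mult.bounded_linear_left mat_mult.bounded_linear_right by blast
  show ?thesis
  proof (rule lie_algI)
    show "((\<lambda>t. g ** \<gamma> t ** g') has_vector_derivative g ** D t ** g') (at t)" for t
      by (rule bounded_linear.has_vector_derivative[OF l a(3)])
    show "continuous_on UNIV (\<lambda>t. g ** D t ** g')"
      by (rule bounded_linear.continuous_on[OF l a(4)])
  qed (use a assms in auto)
qed

text \<open>Differentiate the constant curve \<open>cadjoint (\<gamma> t) ** \<gamma> t\<close> at
  0.\<close>

lemma lie_alg_skew:
  assumes "\<And>g. g \<in> U \<Longrightarrow> cadjoint g ** g = mat 1" and "Z \<in> lie_alg U"
  shows "cadjoint Z = - Z"
  using assms(2)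
proof (rule lie_algE)
  fix \<gamma> D
  assume a: "\<And>t. \<gamma> t \<in> U" "\<gamma> 0 = mat 1" "\<And>t. (\<gamma> has_vector_derivative D t) (at t)" "D 0 = Z"
  have "((\<lambda>t. cadjoint (\<gamma> t) ** \<gamma> t) has_vector_derivative
      (cadjoint (\<gamma> 0) ** D 0 + cadjoint (D 0) ** \<gamma> 0)) (at 0)"
    by (rule mat_mult.has_vector_derivative
      [OF bounded_linear.has_vector_derivative[OF bounded_linear_cadjoint a(3)] a(3)])
  moreover have "((\<lambda>t. cadjoint (\<gamma> t) ** \<gamma> t) has_vector_derivative 0) (at 0)"
    by (simp add: assms a)
  ultimately have "cadjoint (\<gamma> 0) ** D 0 + cadjoint (D 0) ** \<gamma> 0 = 0"
    by (rule vector_derivative_unique_at)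
  then show ?thesis
    using a(2,4) by (simp add: eq_neg_iff_add_eq_0 add.commute)
qed

text \<open>The infinitesimal form of Ad-invariance. By unitarity the conjugates of \<open>X\<close>
  are \<open>\<gamma> t ** X ** cadjoint (\<gamma> t)\<close>; they stay in \<open>W\<close>, and
  skewness of \<open>Z\<close> turns their derivative at 0 into the bracket. The lemma serves both
  for \<open>hh\<close> and for \<open>m\<close>.\<close>

lemma lie_alg_bracket_invariant:
  assumes U: "\<And>g. g \<in> U \<Longrightarrow> cadjoint g ** g = mat 1"
    and W: "subspace W" "\<And>g X. g \<in> U \<Longrightarrow> X \<in> W \<Longrightarrow> g ** X ** matrix_inv g \<in> W"
    and Z: "Z \<in> lie_alg U" and X: "X \<in> W"
  shows "bracket Z X \<in> W"
  using Z
proof (rule lie_algE)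
  fix \<gamma> D
  assume a: "\<And>t. \<gamma> t \<in> U" "\<gamma> 0 = mat 1" "\<And>t. (\<gamma> has_vector_derivative D t) (at t)" "D 0 = Z"
  have "((\<lambda>t. \<gamma> t ** X ** cadjoint (\<gamma> t)) has_vector_derivative
      \<gamma> 0 ** X ** cadjoint (D 0) + D 0 ** X ** cadjoint (\<gamma> 0)) (at 0)"
    by (intro mat_mult.has_vector_derivative a
        bounded_linear.has_vector_derivative[OF bounded_linear_cadjoint]
        bounded_linear.has_vector_derivative[OF mat_mult.bounded_linear_left])
  moreover have "\<gamma> t ** X ** cadjoint (\<gamma> t) \<in> W" for t
    using W(2)[OF a(1) X] matrix_inv_unique[OF U[OF a(1)]] by metis
  ultimately have "\<gamma> 0 ** X ** cadjoint (D 0) + D 0 ** X ** cadjoint (\<gamma> 0) \<in> W"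
    by (rule has_vector_derivative_in_subspace[OF W(1), rotated])
  then show ?thesis
    using lie_alg_skew[OF U Z] a by (simp add: bracket_def mat_mult.minus_right)
qed

section \<open>The group of unitary matrices diag(B, z, z)\<close>

text \<open>The set whose identity component is \<open>SUU\<close>. Closure under products and
  inverses is a direct computation here, and passing to the component does not change the Lie
  algebras of intersections with \<open>F\<close>.\<close>

definition block_SU :: "'i::finite \<Rightarrow> 'i \<Rightarrow> 'i cmat set" where
  "block_SU p q = {g \<in> SU_n1 p q. block_diag p q g}"

lemma block_diag_mult_row:
  assumes "block_diag p q E" "a \<in> {p, q}"
  shows "(E ** X) $ a $ j = E $ p $ p * X $ a $ j"
proof -
  have "(E ** X) $ a $ j = (\<Sum>k\<in>UNIV. if k = a then E $ p $ p * X $ k $ j else 0)"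
    unfolding matrix_matrix_mult_def vec_lambda_beta
    by (rule sum.cong) (use assms in \<open>auto simp: block_diag_def\<close>)
  then show ?thesis by simp
qed

lemma block_diag_mult_col:
  assumes "block_diag p q E" "a \<in> {p, q}"
  shows "(X ** E) $ i $ a = X $ i $ a * E $ p $ p"
proof -
  have "(X ** E) $ i $ a = (\<Sum>k\<in>UNIV. if k = a then X $ i $ k * E $ p $ p else 0)"
    unfolding matrix_matrix_mult_def vec_lambda_beta
    by (rule sum.cong) (use assms in \<open>auto simp: block_diag_def\<close>)
  then show ?thesis by simp
qed

lemma block_diag_mult:
  assumes "block_diag p q E" "block_diag p q E'"
  shows "block_diag p q (E ** E')"
  unfolding block_diag_def
proof (intro conjI allI impI)
  fix i j assume "i \<noteq> j \<and> (i \<in> {p, q} \<or> j \<in> {p, q})"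
  then show "(E ** E') $ i $ j = 0"
    using block_diag_mult_row[OF assms(1), of i E' j] block_diag_mult_col[OF assms(2), of j E i]
      assms by (auto simp: block_diag_def)
next
  show "(E ** E') $ p $ p = (E ** E') $ q $ q"
    using block_diag_mult_row[OF assms(1), of p E' p] block_diag_mult_row[OF assms(1), of q E' q] assms(2)
    by (simp add: block_diag_def[of p q E'])
qed

lemma block_diag_cadjoint: "block_diag p q E \<Longrightarrow> block_diag p q (cadjoint E)"
  by (auto simp: block_diag_def cadjoint_def transpose_def)

lemma subspace_block_diag: "subspace {E. block_diag p q E}"
  by (auto simp: subspace_def block_diag_def)

text \<open>
  Exchanging the coordinates p and q turns the indefinite form into the standard one and commutes
  with the matrices diag(B, z, z), which are therefore unitary.
\<close>

lemma block_SU_unitary: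
  assumes "p \<noteq> q" "g \<in> block_SU p q"
  shows "cadjoint g ** g = mat 1"
proof -
  have bd: "block_diag p q g" and h: "hform p q (g *v X) (g *v Y) = hform p q X Y" for X Y
    using assms by (auto simp: block_SU_def SU_n1_def)
  define s where "s = (\<lambda>Y::complex^'a. \<chi> i. Y $ (if i = p then q else if i = q then p else i))"
  have hs: "hform p q X (s Y) = (\<Sum>i\<in>UNIV. cnj (Y $ i) * X $ i)" for X Y
  proof -
    have "(\<Sum>i\<in>UNIV. cnj (Y $ i) * X $ i)
        = (\<Sum>i\<in>UNIV - {p, q}. cnj (Y $ i) * X $ i) + (\<Sum>i\<in>{p, q}. cnj (Y $ i) * X $ i)"
      by (rule sum.subset_diff) auto
    moreover have "(\<Sum>i\<in>UNIV - {p, q}. cnj (Y $ i) * X $ i)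
        = (\<Sum>i\<in>UNIV - {p, q}. cnj (s Y $ i) * X $ i)"
      by (rule sum.cong) (auto simp: s_def)
    moreover have "(\<Sum>i\<in>{p, q}. cnj (Y $ i) * X $ i) = cnj (s Y $ q) * X $ p + cnj (s Y $ p) * X $ q"
      using assms(1) by (simp add: s_def)
    ultimately show ?thesis
      by (simp only: hform_def add.assoc)
  qed
  have gcol: "(g *v axis j 1) $ i = g $ i $ j" for i j
    by (simp add: matrix_vector_mult_def axis_def if_distrib cong: if_cong)
  have sc: "s (g *v axis j 1) = g *v s (axis j 1)" for j
  proof -
    have "s (axis j 1) = axis (if j = p then q else if j = q then p else j) 1"
      using assms(1) by (auto simp: s_def axis_def vec_eq_iff)
    then show ?thesis
      using bd assms(1) by (auto simp: vec_eq_iff s_def gcol block_diag_def)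
  qed
  \<comment> \<open>The entry is the standard product of columns j and k of \<open>g\<close>. By
    \<open>hs\<close> and \<open>sc\<close> it equals the indefinite form at the images under
    \<open>g\<close> of \<open>axis k 1\<close> and \<open>s (axis j 1)\<close>, so invariance
    removes \<open>g\<close>.\<close>
  have "(cadjoint g ** g) $ j $ k = mat 1 $ j $ k" for j k
  proof -
    have "(cadjoint g ** g) $ j $ k = (\<Sum>i\<in>UNIV. cnj ((g *v axis j 1) $ i) * (g *v axis k 1) $ i)"
      by (simp add: matrix_matrix_mult_def cadjoint_def transpose_def gcol)
    also have "\<dots> = hform p q (axis k 1) (s (axis j 1))"
      by (simp add: hs[symmetric] sc h)
    also have "\<dots> = (\<Sum>i\<in>UNIV. if i = k then (if j = k then 1 else 0) else 0)"
      unfolding hs by (rule sum.cong) (auto simp: axis_def)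
    also have "\<dots> = mat 1 $ j $ k"
      by (simp add: mat_def)
    finally show ?thesis .
  qed
  then show ?thesis
    by (simp add: vec_eq_iff)
qed

lemma block_SU_mult: "g \<in> block_SU p q \<Longrightarrow> h \<in> block_SU p q \<Longrightarrow> g ** h \<in> block_SU p q"
  by (auto simp: block_SU_def SU_n1_def block_diag_mult det_mul matrix_vector_mul_assoc[symmetric]
      simp del: matrix_vector_mul_assoc)

lemma block_SU_one: "mat 1 \<in> block_SU p q"
proof -
  have "block_diag p q (mat 1)"
    by (auto simp: block_diag_def mat_def)
  then show ?thesis
    by (simp add: block_SU_def SU_n1_def)
qed

text \<open>The inverse is the adjoint, whose block shape is visible. Invariance of the form under
  it follows by applying the invariance of \<open>g\<close> to vectors already multiplied by the
  adjoint.\<close>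

lemma block_SU_inv:
  assumes "p \<noteq> q" "g \<in> block_SU p q"
  shows "matrix_inv g \<in> block_SU p q"
proof -
  have inv: "matrix_inv g = cadjoint g" "cadjoint g ** g = mat 1"
    using block_SU_unitary[OF assms] matrix_inv_unique by blast+
  then have inv': "g ** cadjoint g = mat 1"
    using matrix_left_right_inverse by blast
  have g: "det g = 1" "hform p q (g *v X) (g *v Y) = hform p q X Y" "block_diag p q g" for X Y
    using assms by (auto simp: block_SU_def SU_n1_def)
  have "det (cadjoint g) = 1"
    using arg_cong[OF inv(2), of det] g by (simp add: det_mul)
  moreover have "hform p q (cadjoint g *v X) (cadjoint g *v Y) = hform p q X Y" for X Y
    using g(2)[of "cadjoint g *v X" "cadjoint g *v Y"]
    by (simp add: matrix_vector_mul_assoc inv')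
  ultimately show ?thesis
    using g block_diag_cadjoint inv(1) by (simp add: block_SU_def SU_n1_def)
qed

lemma SUU_subset_block_SU: "SUU p q \<subseteq> block_SU p q"
  unfolding SUU_def block_SU_def by (rule connected_component_subset)

text \<open>A curve through the identity never leaves the identity component.\<close>

lemma lie_alg_SUU: "lie_alg (F \<inter> SUU p q) = lie_alg (F \<inter> block_SU p q)"
proof
  show "lie_alg (F \<inter> SUU p q) \<subseteq> lie_alg (F \<inter> block_SU p q)"
    using SUU_subset_block_SU by (intro lie_alg_mono) blast
next
  show "lie_alg (F \<inter> block_SU p q) \<subseteq> lie_alg (F \<inter> SUU p q)"
  proof
    fix X assume "X \<in> lie_alg (F \<inter> block_SU p q)"
    then obtain \<gamma> D where a: "\<And>t. \<gamma> t \<in> F \<inter> block_SU p q" "\<gamma> 0 = mat 1"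
      "\<And>t. (\<gamma> has_vector_derivative D t) (at t)" "continuous_on UNIV D" "D 0 = X"
      "continuous_on UNIV \<gamma>"
      using lie_algE by blast
    have "range \<gamma> \<subseteq> SUU p q"
      unfolding SUU_def
    proof (rule connected_component_maximal)
      show "connected (range \<gamma>)"
        using a(6) by (rule connected_continuous_image) simp
      show "mat 1 \<in> range \<gamma>"
        by (rule range_eqI[of _ _ 0]) (simp add: a)
      show "range \<gamma> \<subseteq> {g \<in> SU_n1 p q. block_diag p q g}"
        using a(1) by (auto simp: block_SU_def)
    qed
    then show "X \<in> lie_alg (F \<inter> SUU p q)"
      using a by (intro lie_algI[of \<gamma> _ D]) auto
  qed
qed

text \<open>The block shape is a linear condition, hence inherited by velocities.\<close>

lemma lie_alg_block_SU_block_diag: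
  assumes "Z \<in> lie_alg (block_SU p q)"
  shows "block_diag p q Z"
proof -
  obtain \<gamma> D where a: "\<And>t. \<gamma> t \<in> block_SU p q" "\<And>t. (\<gamma> has_vector_derivative D t) (at t)" "D 0 = Z"
    using assms lie_algE by blast
  show ?thesis
    using has_vector_derivative_in_subspace[OF subspace_block_diag _ a(2)[of 0]] a(1,3)
    by (auto simp: block_SU_def)
qed

section \<open>Bracket relations among a, n and the block-diagonal matrices\<close>

text \<open>ad of a diagonal matrix scales entry (i, j) by the difference of the diagonal values at
  i and j; this gives the weights 1 on \<open>lie_n1\<close> and 2 on \<open>N2\<close>.\<close>

lemma bracket_A0_entry:
  assumes "p \<noteq> q"
  shows "bracket (A0 p q) X $ i $ j
    = ((if i = p then 1 else if i = q then -1 else 0)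
        - (if j = p then 1 else if j = q then -1 else 0)) * X $ i $ j"
proof -
  define a where "a = (\<lambda>k. if k = p then 1 else if k = q then -1 else (0::complex))"
  have "(A0 p q ** X) $ i $ j = (\<Sum>k\<in>UNIV. if k = i then a i * X $ i $ j else 0)"
    unfolding matrix_matrix_mult_def vec_lambda_beta
    by (rule sum.cong) (use assms in \<open>auto simp: A0_def a_def\<close>)
  moreover have "(X ** A0 p q) $ i $ j = (\<Sum>k\<in>UNIV. if k = j then a j * X $ i $ j else 0)"
    unfolding matrix_matrix_mult_def vec_lambda_beta
    by (rule sum.cong) (use assms in \<open>auto simp: A0_def a_def\<close>)
  ultimately have "bracket (A0 p q) X $ i $ j = (a i - a j) * X $ i $ j"
    by (simp add: bracket_def left_diff_distrib)
  then show ?thesis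
    unfolding a_def .
qed

lemma bracket_A0_n1:
  assumes "p \<noteq> q" "X \<in> lie_n1 p q"
  shows "bracket (A0 p q) X = X"
  using assms by (auto simp: vec_eq_iff bracket_A0_entry lie_n1_def n1_elem_def)

lemma bracket_A0_N2:
  assumes "p \<noteq> q"
  shows "bracket (A0 p q) (N2 p q) = 2 *\<^sub>R N2 p q"
  using assms by (auto simp: vec_eq_iff bracket_A0_entry N2_def scaleR_conv_of_real)

text \<open>\<open>N2\<close> is \<i> times a matrix unit: from the left it moves row q to row p,
  from the right it moves column p to column q.\<close>

lemma bracket_N2_entry:
  "bracket (N2 p q) X $ i $ j
    = (if i = p then \<i> * X $ q $ j else 0) - (if j = q then \<i> * X $ i $ p else 0)"
proof -
  have "(N2 p q ** X) $ i $ j = (\<Sum>k\<in>UNIV. if k = q then (if i = p then \<i> * X $ q $ j else 0) else 0)"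
    unfolding matrix_matrix_mult_def vec_lambda_beta
    by (rule sum.cong) (auto simp: N2_def)
  moreover have "(X ** N2 p q) $ i $ j
      = (\<Sum>k\<in>UNIV. if k = p then (if j = q then \<i> * X $ i $ p else 0) else 0)"
    unfolding matrix_matrix_mult_def vec_lambda_beta
    by (rule sum.cong) (auto simp: N2_def)
  ultimately show ?thesis
    by (simp add: bracket_def)
qed

text \<open>Only entry (p, q) could survive, and there the two terms cancel because the diagonal
  entries at p and q agree.\<close>

lemma bracket_N2_block_diag: "block_diag p q E \<Longrightarrow> bracket (N2 p q) E = 0"
  by (auto simp: vec_eq_iff bracket_N2_entry block_diag_def)

lemma bracket_N2_n1: "p \<noteq> q \<Longrightarrow> X \<in> lie_n1 p q \<Longrightarrow> bracket (N2 p q) X = 0"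
  by (auto simp: vec_eq_iff bracket_N2_entry lie_n1_def n1_elem_def)

lemma subspace_lie_n1: "subspace (lie_n1 p q)"
  unfolding lie_n1_def
  by (intro linear_subspace_image subspace_UNIV linearI)
    (auto simp: n1_elem_def vec_eq_iff)

text \<open>An entrywise test for membership without exhibiting the vector v, which is read off from
  column q.\<close>

lemma lie_n1_iff:
  "X \<in> lie_n1 p q \<longleftrightarrow>
    (\<forall>i j. \<not> (i \<notin> {p, q} \<and> j = q) \<longrightarrow> \<not> (i = p \<and> j \<notin> {p, q}) \<longrightarrow> X $ i $ j = 0) \<and>
    (\<forall>j. j \<notin> {p, q} \<longrightarrow> X $ p $ j = - cnj (X $ j $ q))" (is "_ \<longleftrightarrow> ?R")
proof
  assume "X \<in> lie_n1 p q"
  then show ?R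
    by (auto simp: lie_n1_def n1_elem_def)
next
  assume ?R
  then have "X = n1_elem p q (\<chi> i. X $ i $ q)"
    by (auto simp: vec_eq_iff n1_elem_def)
  then show "X \<in> lie_n1 p q"
    by (auto simp: lie_n1_def)
qed

text \<open>diag(B, z, z) acts on n1 by sending v to Bv - zv. Applied to \<open>Hr0\<close>, this
  makes \<open>f\<close> preserve n1.\<close>

lemma bracket_block_diag_n1:
  assumes "p \<noteq> q" and E: "block_diag p q E" "cadjoint E = - E" and X: "X \<in> lie_n1 p q"
  shows "bracket E X \<in> lie_n1 p q"
proof -
  have Ez: "E $ i $ j = 0" if "i \<noteq> j" "i \<in> {p, q} \<or> j \<in> {p, q}" for i j
    using E(1) that by (auto simp: block_diag_def)
  have skew: "cnj (E $ i $ j) = - E $ j $ i" for i j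
  proof -
    have "cadjoint E $ j $ i = - E $ j $ i"
      by (simp add: E(2))
    then show ?thesis
      by (simp add: cadjoint_def transpose_def)
  qed
  have Xz: "X $ i $ j = 0" if "\<not> (i \<notin> {p, q} \<and> j = q)" "\<not> (i = p \<and> j \<notin> {p, q})" for i j
    using X that unfolding lie_n1_iff by blast
  have Xc: "X $ p $ j = - cnj (X $ j $ q)" if "j \<notin> {p, q}" for j
    using X that unfolding lie_n1_iff by blast
  \<comment> \<open>Every summand of both products vanishes: \<open>E\<close> does not mix the first
    block with p or q, so multiplying by it keeps the zero pattern of \<open>X\<close>.\<close>
  have zero: "bracket E X $ i $ j = 0"
    if "\<not> (i \<notin> {p, q} \<and> j = q)" "\<not> (i = p \<and> j \<notin> {p, q})" for i j
  proof -
    have "E $ i $ k * X $ k $ j = 0" if "k \<noteq> i" for k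
      using Ez[of i k] Xz[of k j] \<open>\<not> (i \<notin> {p, q} \<and> j = q)\<close> \<open>\<not> (i = p \<and> j \<notin> {p, q})\<close> that
      by (cases "k = p"; cases "i \<in> {p, q}"; cases "k = q") auto
    moreover have "X $ i $ k * E $ k $ j = 0" if "k \<noteq> j" for k
      using Ez[of k j] Xz[of i k] \<open>\<not> (i \<notin> {p, q} \<and> j = q)\<close> \<open>\<not> (i = p \<and> j \<notin> {p, q})\<close> that
      by (cases "k = p"; cases "j \<in> {p, q}"; cases "k = q") auto
    ultimately have "E $ i $ k * X $ k $ j = 0" "X $ i $ k * E $ k $ j = 0" for k
      using Xz[OF that] by (metis mult_zero_left mult_zero_right)+
    then show ?thesis
      by (simp only: bracket_def matrix_matrix_mult_def vector_minus_component vec_lambda_beta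
          sum.neutral_const diff_zero)
  qed
  \<comment> \<open>Conjugation exchanges the two products: \<open>X ** E\<close> at (p, j) matches
    \<open>E ** X\<close> at (j, q), and conversely. The exchange produces the minus sign.\<close>
  have conj: "bracket E X $ p $ j = - cnj (bracket E X $ j $ q)" if j: "j \<notin> {p, q}" for j
  proof -
    have "X $ p $ k * E $ k $ j = cnj (E $ j $ k * X $ k $ q)" for k
    proof (cases "k \<in> {p, q}")
      case True
      then show ?thesis
        using Xz[of p k] Xz[of k q] by simp
    next
      case False
      show ?thesis
        by (simp add: Xc[OF False] skew)
    qed
    then have "(X ** E) $ p $ j = cnj ((E ** X) $ j $ q)"
      by (simp add: matrix_matrix_mult_def)
    moreover have "(E ** X) $ p $ j = cnj ((X ** E) $ j $ q)"
      by (simp add: block_diag_mult_row[OF E(1)] block_diag_mult_col[OF E(1)] Xc[OF j] skew)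
    ultimately show ?thesis
      by (simp add: bracket_def)
  qed
  show ?thesis
    unfolding lie_n1_iff using zero conj by blast
qed

text \<open>A product of two elements of n1 lives at (p, q), with value -v*w. The commutator entry
  is therefore \<open>z - cnj z\<close>, which is 2\<i> times the imaginary part of
  \<open>z\<close>.\<close>

lemma bracket_n1_n1:
  assumes "p \<noteq> q" "X \<in> lie_n1 p q" "Y \<in> lie_n1 p q"
  shows "bracket X Y = (2 * omega0 p q X Y) *\<^sub>R N2 p q"
proof -
  obtain v w where vw: "X = n1_elem p q v" "Y = n1_elem p q w"
    using assms by (auto simp: lie_n1_def)
  define z where "z = (\<Sum>k\<in>UNIV - {p, q}. cnj (w $ k) * v $ k)"
  have mult: "(n1_elem p q a ** n1_elem p q b) $ i $ j
    = (if i = p \<and> j = q then - (\<Sum>k\<in>UNIV - {p, q}. cnj (a $ k) * b $ k) else 0)" for a b i j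
  proof -
    have "(n1_elem p q a ** n1_elem p q b) $ i $ j
      = (\<Sum>k\<in>UNIV - {p, q}. n1_elem p q a $ i $ k * n1_elem p q b $ k $ j)"
      unfolding matrix_matrix_mult_def vec_lambda_beta
      by (rule sum.mono_neutral_right) (use assms(1) in \<open>auto simp: n1_elem_def\<close>)
    also have "\<dots> = (\<Sum>k\<in>UNIV - {p, q}. if i = p \<and> j = q then - (cnj (a $ k) * b $ k) else 0)"
      by (rule sum.cong) (auto simp: n1_elem_def)
    finally show ?thesis
      by (auto simp: sum_negf)
  qed
  have "(\<Sum>k\<in>UNIV - {p, q}. cnj (v $ k) * w $ k) = cnj z"
    by (simp add: z_def mult.commute)
  moreover have "omega0 p q X Y = Im z"
  proof -
    have "(\<Sum>i\<in>UNIV - {p, q}. cnj (Y $ i $ q) * X $ i $ q) = z"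
      unfolding z_def vw by (rule sum.cong) (auto simp: n1_elem_def)
    then show ?thesis
      by (simp add: omega0_def)
  qed
  ultimately have "bracket X Y $ i $ j = ((2 * omega0 p q X Y) *\<^sub>R N2 p q) $ i $ j" for i j
    by (simp add: bracket_def vw mult z_def[symmetric] N2_def complex_eq_iff)
  then show ?thesis
    by (simp add: vec_eq_iff)
qed

section \<open>Elements of n as velocities of exponential curves in N\<close>

lemma subspace_lie_n: "subspace (lie_n p q)"
  unfolding lie_n_def lie_n2_def set_plus_def
  using subspace_sums[OF subspace_lie_n1 subspace_span]
  by (rule back_subst[of subspace]) auto

lemma n1_subset_n: "lie_n1 p q \<subseteq> lie_n p q"
proof
  fix X assume "X \<in> lie_n1 p q"
  from set_plus_intro[OF this span_zero[of "{N2 p q}"]] show "X \<in> lie_n p q"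
    by (simp add: lie_n_def lie_n2_def)
qed

lemma N2_in_n: "N2 p q \<in> lie_n p q"
  using set_plus_intro[OF subspace_0[OF subspace_lie_n1[of p q]] span_base[of "N2 p q" "{N2 p q}"]]
  by (simp add: lie_n_def lie_n2_def)

text \<open>In the order p, first block, q these matrices are strictly block upper triangular with
  three blocks, which makes their cubes vanish.\<close>

lemma lie_n_entries:
  assumes "p \<noteq> q" "X \<in> lie_n p q"
  shows "X $ i $ p = 0" "X $ q $ j = 0" "i \<noteq> p \<Longrightarrow> j \<noteq> q \<Longrightarrow> X $ i $ j = 0"
proof -
  obtain v c where "X = n1_elem p q v + c *\<^sub>R N2 p q"
    using assms(2) unfolding lie_n_def lie_n2_def lie_n1_def span_singleton
    by (elim set_plus_elim) blast
  then show "X $ i $ p = 0" "X $ q $ j = 0" "i \<noteq> p \<Longrightarrow> j \<noteq> q \<Longrightarrow> X $ i $ j = 0"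
    using assms(1) by (simp_all add: n1_elem_def N2_def)
qed

lemma lie_n_cube:
  assumes "p \<noteq> q" "X \<in> lie_n p q"
  shows "X ** (X ** X) = 0"
proof -
  note e = lie_n_entries[OF assms]
  have sq: "(X ** X) $ k $ j = 0" if "k \<noteq> p" for k j
  proof -
    have "X $ k $ l * X $ l $ j = 0" for l
      using that e by (cases "l = q") auto
    then show ?thesis
      by (simp only: matrix_matrix_mult_def vec_lambda_beta sum.neutral_const)
  qed
  have "(X ** (X ** X)) $ i $ j = 0" for i j
  proof -
    have "X $ i $ k * (X ** X) $ k $ j = 0" for k
      using sq[of k j] e(1)[of i] by (cases "k = p") auto
    then show ?thesis
      by (simp only: matrix_matrix_mult_def[of X "X ** X"] vec_lambda_beta sum.neutral_const)
  qed
  then show ?thesis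
    by (simp add: vec_eq_iff)
qed

text \<open>The exponential of an element of n becomes a quadratic polynomial, so its curves are
  differentiated without any power series.\<close>

lemma mat_exp_nilpotent:
  assumes "X ** (X ** X) = 0"
  shows "mat_exp X = mat 1 + X + (1/2) *\<^sub>R (X ** X)"
proof -
  have "(\<Sum>k. (1 / fact k) *\<^sub>R mat_pow X k) = (\<Sum>k\<in>{0,1,2}. (1 / fact k) *\<^sub>R mat_pow X k)"
  proof (rule suminf_finite)
    fix k :: nat assume "k \<notin> {0,1,2}"
    then obtain l where "k = Suc (Suc (Suc l))"
      by (metis One_nat_def Suc_1 insertCI not0_implies_Suc)
    then have "mat_pow X k = (X ** (X ** X)) ** mat_pow X l"
      by (simp add: mat_pow_def matrix_mul_assoc)
    then show "(1 / fact k) *\<^sub>R mat_pow X k = 0"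
      by (simp add: assms mat_mult.zero_left)
  qed simp
  then show ?thesis
    by (simp add: mat_exp_def mat_pow_def numeral_2_eq_2)
qed

lemma lie_n_subset_lie_alg:
  assumes "p \<noteq> q"
  shows "lie_n p q \<subseteq> lie_alg (N_group p q)"
proof
  fix X assume X: "X \<in> lie_n p q"
  have exp: "mat_exp (t *\<^sub>R X) = mat 1 + t *\<^sub>R X + (t\<^sup>2 / 2) *\<^sub>R (X ** X)" for t
    using mat_exp_nilpotent[OF lie_n_cube[OF assms subspace_scale[OF subspace_lie_n X]], of t]
    by (simp add: mat_mult.scaleR_left mat_mult.scaleR_right power2_eq_square)
  show "X \<in> lie_alg (N_group p q)"
  proof (rule lie_algI)
    show "((\<lambda>t. mat_exp (t *\<^sub>R X)) has_vector_derivative (X + t *\<^sub>R (X ** X))) (at t)" for t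
      unfolding exp by (auto intro!: derivative_eq_intros)
    show "mat_exp (t *\<^sub>R X) \<in> N_group p q" for t
      using subspace_scale[OF subspace_lie_n X] by (auto simp: N_group_def)
    show "continuous_on UNIV (\<lambda>t. X + t *\<^sub>R (X ** X))"
      by (intro continuous_intros)
    show "mat_exp (0 *\<^sub>R X) = mat 1"
      unfolding exp by simp
  qed simp
qed

lemma one_in_N_group: "mat 1 \<in> N_group p q"
proof -
  have "mat_exp 0 = (mat 1 :: 'a cmat)"
    using mat_exp_nilpotent[of "0 :: 'a cmat"] by (simp add: mat_mult.zero_left)
  then show ?thesis
    using subspace_0[OF subspace_lie_n[of p q]] unfolding N_group_def by (metis image_eqI)
qed

section \<open>Splitting along \<open>hh\<close> and \<open>m\<close>\<close>

text \<open>Two candidates differ by an element of \<open>hh \<inter> m\<close>. Each curvature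
  formula thereby reduces to two membership checks.\<close>

lemma h_part_eq:
  assumes sub: "subspace hh" "subspace m" and disj: "hh \<inter> m = {0}"
    and Z: "Z \<in> hh" "W - Z \<in> m"
  shows "h_part hh m W = Z"
  unfolding h_part_def
proof (rule the_equality)
  fix Z' assume Z': "Z' \<in> hh \<and> W - Z' \<in> m"
  have "Z' - Z \<in> hh"
    using subspace_diff[OF sub(1)] Z' Z(1) by blast
  moreover have "Z' - Z \<in> m"
    using subspace_diff[OF sub(2) Z(2), of "W - Z'"] Z' by simp
  ultimately have "Z' - Z \<in> {0}"
    unfolding disj[symmetric] by (rule IntI)
  then show "Z' = Z"
    by simp
qed (simp add: Z)

text \<open>The graph map is minus the projection to \<open>hh\<close> along \<open>m\<close>, so
  its uniqueness reduces to that of \<open>h_part\<close>.\<close>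

lemma graph_map_in:
  assumes sub: "subspace hh" "subspace m" and disj: "hh \<inter> m = {0}" and S: "S \<in> hh + m"
  shows "graph_map hh m S \<in> hh" "S + graph_map hh m S \<in> m"
proof -
  obtain Z V where Z: "Z \<in> hh" and V: "V \<in> m" and "S = Z + V"
    using S by (rule set_plus_elim)
  then have *: "- Z \<in> hh \<and> S + (- Z) \<in> m"
    using subspace_neg[OF sub(1)] by simp
  have "graph_map hh m S = - Z"
    unfolding graph_map_def
  proof (rule the_equality)
    show "- Z \<in> hh \<and> S + (- Z) \<in> m"
      by (rule *)
  next
    fix Z' assume Z': "Z' \<in> hh \<and> S + Z' \<in> m"
    have "h_part hh m S = - Z'"
      using h_part_eq[OF sub disj, of "- Z'" S] Z' subspace_neg[OF sub(1)] by simp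
    moreover have "h_part hh m S = Z"
      using h_part_eq[OF sub disj Z, of S] * by simp
    ultimately show "Z' = - Z"
      by simp
  qed
  then show "graph_map hh m S \<in> hh" "S + graph_map hh m S \<in> m"
    using * by simp_all
qed

lemma mat_set_mult_superset:
  "mat 1 \<in> S \<Longrightarrow> T \<subseteq> mat_set_mult S T" "mat 1 \<in> T \<Longrightarrow> S \<subseteq> mat_set_mult S T"
proof -
  show "T \<subseteq> mat_set_mult S T" if "mat 1 \<in> S"
  proof
    fix t assume "t \<in> T"
    then have "mat 1 ** t \<in> mat_set_mult S T"
      unfolding mat_set_mult_def using that by blast
    then show "t \<in> mat_set_mult S T"
      by simp
  qed
  show "S \<subseteq> mat_set_mult S T" if "mat 1 \<in> T"
  proof
    fix s assume "s \<in> S"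
    then have "s ** mat 1 \<in> mat_set_mult S T"
      unfolding mat_set_mult_def using that by blast
    then show "s \<in> mat_set_mult S T"
      by simp
  qed
qed

section \<open>The curvature formulas\<close>

theorem corollary3p2:
  fixes p q :: "'i::finite"
    and F G H hh m :: "'i cmat set"
    and Hr Hr0 :: "'i cmat"
    and chi phi tilde f :: "'i cmat \<Rightarrow> 'i cmat"
    and R :: "'i cmat \<Rightarrow> 'i cmat \<Rightarrow> 'i cmat"
  assumes "p \<noteq> q"
    and "nonsymmetric_F p q F"
    and "G = mat_set_mult F (N_group p q)"
    and "H = F \<inter> SUU p q"
    and "hh = lie_alg H"
    and "Hr \<in> suu p q"
    and "orth_complement hh (lie_alg F) = span {A0 p q + Hr}"
    and "reductive_decomposition G H m"
    and "linear chi" and "\<forall>X\<in>lie_n p q. chi X = X" and "chi (A0 p q) = A0 p q + Hr"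
    and "phi = graph_map hh m \<circ> chi"
    and "tilde = (\<lambda>X. chi X + phi X)"
    and "R = canonical_curvature hh m"
    and "Hr0 = Hr + phi (A0 p q)"
    and "f = (\<lambda>X. X + bracket Hr0 X)"
  shows "\<forall>X\<in>lie_n1 p q. \<forall>Y\<in>lie_n1 p q.
      R (tilde (A0 p q)) (tilde X) = - phi (f X) \<and>
      R (tilde (A0 p q)) (tilde (N2 p q)) = - 2 *\<^sub>R phi (N2 p q) \<and>
      R (tilde (N2 p q)) (tilde X) = 0 \<and>
      R (tilde X) (tilde Y) =
        - (2 * omega0 p q X Y) *\<^sub>R phi (N2 p q) - bracket (phi X) (phi Y)"
proof (intro ballI)
  fix X Y assume X: "X \<in> lie_n1 p q" and Y: "Y \<in> lie_n1 p q"
  note pq = assms(1) and chi_n = assms(10) and chi_A = assms(11)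
  have F: "mat 1 \<in> F" "\<And>g h. g \<in> F \<Longrightarrow> h \<in> F \<Longrightarrow> g ** h \<in> F" "\<And>g. g \<in> F \<Longrightarrow> matrix_inv g \<in> F"
    using assms(2) by (auto simp: nonsymmetric_F_def matrix_group_def)
  \<comment> \<open>\<open>U\<close> stands in for \<open>H\<close>: it has the same Lie algebra,
    and its closure under products and inverses is already available.\<close>
  define U where "U = F \<inter> block_SU p q"
  have U_one: "mat 1 \<in> U" and U_mult: "\<And>g h. g \<in> U \<Longrightarrow> h \<in> U \<Longrightarrow> g ** h \<in> U"
    and U_inv: "\<And>g. g \<in> U \<Longrightarrow> matrix_inv g \<in> U"
    and U_unitary: "\<And>g. g \<in> U \<Longrightarrow> cadjoint g ** g = mat 1"
    using F block_SU_one block_SU_mult block_SU_inv[OF pq] block_SU_unitary[OF pq] by (auto simp: U_def)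
  have hh: "hh = lie_alg U"
    using lie_alg_SUU assms(4,5) by (auto simp: U_def)
  have hh_sub: "subspace hh"
    unfolding hh by (rule subspace_lie_alg[OF U_one U_mult])
  have hh_bd: "block_diag p q Z" if "Z \<in> hh" for Z
    using that lie_alg_mono[of U "block_SU p q"] lie_alg_block_SU_block_diag by (auto simp: U_def hh)
  have hh_skew: "cadjoint Z = - Z" if "Z \<in> hh" for Z
    using that lie_alg_skew[OF U_unitary] by (auto simp: hh)
  have hh_bracket: "bracket Z W \<in> hh" if "Z \<in> hh" "W \<in> hh" for Z W
  proof (rule lie_alg_bracket_invariant[OF U_unitary hh_sub])
    fix g V assume g: "g \<in> U" and V: "V \<in> hh"
    have "g ** matrix_inv g = mat 1"
      using matrix_inv_unique[OF U_unitary[OF g]] U_unitary[OF g] matrix_left_right_inverse by metis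
    then show "g ** V ** matrix_inv g \<in> hh"
      using V unfolding hh by (intro lie_alg_conj) (auto intro: U_mult U_inv g)
  qed (use that hh in auto)
  have m: "subspace m" "lie_alg G = hh + m" "hh \<inter> m = {0}"
    and m_inv: "\<And>g V. g \<in> H \<Longrightarrow> V \<in> m \<Longrightarrow> g ** V ** matrix_inv g \<in> m"
    using assms(5,8) by (auto simp: reductive_decomposition_def)
  \<comment> \<open>Here the group has to be \<open>H\<close>, for which the invariance of
    \<open>m\<close> is assumed.\<close>
  have m_bracket: "bracket Z V \<in> m" if "Z \<in> hh" "V \<in> m" for Z V
  proof (rule lie_alg_bracket_invariant[OF _ m(1) m_inv])
    show "cadjoint g ** g = mat 1" if "g \<in> H" for g
      using that block_SU_unitary[OF pq] SUU_subset_block_SU by (auto simp: assms(4))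
  qed (use that assms(5) in auto)
  note graph = graph_map_in[OF hh_sub m(1,3), folded m(2)]
  have n_G: "lie_n p q \<subseteq> lie_alg G"
  proof -
    have "N_group p q \<subseteq> G"
      unfolding assms(3) by (rule mat_set_mult_superset(1)[OF F(1)])
    then show ?thesis
      using lie_n_subset_lie_alg[OF pq] lie_alg_mono by blast
  qed
  have A_G: "A0 p q + Hr \<in> lie_alg G"
  proof -
    have "F \<subseteq> G"
      unfolding assms(3) by (rule mat_set_mult_superset(2)[OF one_in_N_group])
    moreover have "A0 p q + Hr \<in> lie_alg F"
      using assms(7) span_base[of "A0 p q + Hr" "{A0 p q + Hr}"] by (auto simp: orth_complement_def)
    ultimately show ?thesis
      using lie_alg_mono by blast
  qed
  have phi_n: "phi V \<in> hh" "V + phi V \<in> m" "tilde V = V + phi V" if "V \<in> lie_n p q" for V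
    using graph[of V] n_G that chi_n by (auto simp: assms(12,13))
  \<comment> \<open>As \<open>chi\<close> adds \<open>Hr\<close> to \<open>A0\<close> and
    \<open>phi\<close> adds its value, the lift of \<open>A0\<close> is exactly
    \<open>A0 + Hr0\<close>.\<close>
  have phi_A: "phi (A0 p q) \<in> hh" "A0 p q + Hr0 \<in> m" "tilde (A0 p q) = A0 p q + Hr0"
    using graph[OF A_G] by (auto simp: assms(12,13,15) chi_A add.assoc)
  have Hr0_bd: "block_diag p q Hr0" and Hr0_skew: "cadjoint Hr0 = - Hr0"
  proof -
    show "block_diag p q Hr0"
      using subspace_add[OF subspace_block_diag, of Hr p q "phi (A0 p q)"] hh_bd[OF phi_A(1)]
        assms(6) by (simp add: assms(15) suu_def)
    show "cadjoint Hr0 = - Hr0"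
      using hh_skew[OF phi_A(1)] assms(6)
        linear_add[OF bounded_linear.linear[OF bounded_linear_cadjoint], of Hr "phi (A0 p q)"]
      by (simp add: assms(15) suu_def)
  qed
  have n1: "V \<in> lie_n p q" if "V \<in> lie_n1 p q" for V
    using n1_subset_n that by blast
  note phi_X = phi_n[OF n1[OF X]] and phi_Y = phi_n[OF n1[OF Y]] and phi_N2 = phi_n[OF N2_in_n]
  have R: "R B C = Z" if "Z \<in> hh" "bracket B C - Z \<in> m" for B C Z
    using h_part_eq[OF hh_sub m(1,3) that] by (simp add: assms(14) canonical_curvature_def)
  have m_bracket': "bracket V Z \<in> m" if "Z \<in> hh" "V \<in> m" for Z V
    using subspace_neg[OF m(1) m_bracket[OF that]] bracket_swap[of V Z] by simp

  \<comment> \<open>Membership in n1 makes \<open>f X + phi (f X)\<close> an element of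
    \<open>m\<close>.\<close>
  have "f X \<in> lie_n1 p q"
    unfolding assms(16)
    by (intro subspace_add[OF subspace_lie_n1] X bracket_block_diag_n1[OF pq Hr0_bd Hr0_skew X])
  note phi_f = phi_n[OF n1[OF this]]
  have "bracket (A0 p q + Hr0) X = f X"
    by (simp add: assms(16) bracket.add_left bracket_A0_n1[OF pq X])
  then have "bracket (tilde (A0 p q)) (tilde X) - (- phi (f X))
      = (f X + phi (f X)) + bracket (A0 p q + Hr0) (phi X)"
    by (simp add: phi_A(3) phi_X(3) bracket.add_right)
  also have "\<dots> \<in> m"
    by (intro subspace_add[OF m(1)] phi_f m_bracket' phi_X phi_A)
  finally have A_X: "R (tilde (A0 p q)) (tilde X) = - phi (f X)"
    by (intro R subspace_neg[OF hh_sub] phi_f)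

  have "bracket (A0 p q + Hr0) (N2 p q) = 2 *\<^sub>R N2 p q"
    using bracket_N2_block_diag[OF Hr0_bd] bracket_swap[of Hr0 "N2 p q"]
    by (simp add: bracket.add_left bracket_A0_N2[OF pq])
  then have "bracket (tilde (A0 p q)) (tilde (N2 p q)) - (- 2 *\<^sub>R phi (N2 p q))
      = 2 *\<^sub>R (N2 p q + phi (N2 p q)) + bracket (A0 p q + Hr0) (phi (N2 p q))"
    by (simp add: phi_A(3) phi_N2(3) bracket.add_right scaleR_add_right)
  also have "\<dots> \<in> m"
    by (intro subspace_add[OF m(1)] subspace_scale[OF m(1)] phi_N2 m_bracket' phi_A)
  finally have A_N2: "R (tilde (A0 p q)) (tilde (N2 p q)) = - 2 *\<^sub>R phi (N2 p q)"
    by (intro R subspace_scale[OF hh_sub] phi_N2)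

  \<comment> \<open>\<open>N2\<close> commutes with \<open>X\<close> and with \<open>phi X\<close>,
    so only the part \<open>phi (N2 p q)\<close> of its lift acts.\<close>
  have "bracket (tilde (N2 p q)) (tilde X) - 0 = bracket (phi (N2 p q)) (X + phi X)"
    by (simp add: phi_N2(3) phi_X(3) bracket.add_left bracket.add_right
        bracket_N2_n1[OF pq X] bracket_N2_block_diag[OF hh_bd[OF phi_X(1)]])
  also have "\<dots> \<in> m"
    by (intro m_bracket phi_N2 phi_X)
  finally have N2_X: "R (tilde (N2 p q)) (tilde X) = 0"
    by (intro R subspace_0[OF hh_sub])

  let ?w = "2 * omega0 p q X Y"
  \<comment> \<open>Subtracting the claimed value adds a second copy of
    \<open>bracket (phi X) (phi Y)\<close>, which lets both mixed brackets be completed to elements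
    of \<open>m\<close>.\<close>
  have "bracket (tilde X) (tilde Y) - (- ?w *\<^sub>R phi (N2 p q) - bracket (phi X) (phi Y))
      = ?w *\<^sub>R (N2 p q + phi (N2 p q)) + bracket (phi X) (Y + phi Y) + bracket (X + phi X) (phi Y)"
    by (simp add: phi_X(3) phi_Y(3) bracket.add_left bracket.add_right scaleR_add_right
        bracket_n1_n1[OF pq X Y])
  also have "\<dots> \<in> m"
    by (intro subspace_add[OF m(1)] subspace_scale[OF m(1)] m_bracket m_bracket' phi_N2 phi_X phi_Y)
  finally have X_Y: "R (tilde X) (tilde Y) = - ?w *\<^sub>R phi (N2 p q) - bracket (phi X) (phi Y)"
    by (intro R subspace_diff[OF hh_sub] subspace_scale[OF hh_sub] hh_bracket phi_N2 phi_X phi_Y)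

  from A_X A_N2 N2_X X_Y
  show "R (tilde (A0 p q)) (tilde X) = - phi (f X) \<and>
      R (tilde (A0 p q)) (tilde (N2 p q)) = - 2 *\<^sub>R phi (N2 p q) \<and>
      R (tilde (N2 p q)) (tilde X) = 0 \<and>
      R (tilde X) (tilde Y) =
        - (2 * omega0 p q X Y) *\<^sub>R phi (N2 p q) - bracket (phi X) (phi Y)"
    by blast
qed

end
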